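(* Let $m\ge2$ be even and let $q$ be an odd prime with $q\equiv1\pmod m$. For each $z\in\mu_m(\mathbb F_q)$ the assignments $$\rho_z(s)=\begin{pmatrix}z&0\\0&-z\end{pmatrix},\qquad \rho_z(t)=\begin{pmatrix}0&-1\\1&0\end{pmatrix}$$ define an $\mathbb F_q$-algebra homomorphism $\rho_z:R^I_{m,q}\to M_2(\mathbb F_q)$; $\rho_z$ and $\rho_{-z}$ are conjugate; and choosing one representative $z$ from each pair $\{z,-z\}$ the product of the $\rho_z$ is an isomorphism $$R^I_{m,q}\;\cong\prod_{z\in\mu_m(\mathbb F_q)/\{\pm1\}}M_2(\mathbb F_q).$$
   Context: $R^I_{m,q}$ is the $\mathbb F_q$-algebra generated by $s,t$ with relations $s^m=1$, $t^2=-1$, $st=-ts$; it has dimension $2m$ with basis $s^i,\,s^it$ ($0\le i<m$). (It is the reduction modulo $q$ of the quotient by $t^2+1$ of the integral group ring of the semidirect product $\langle s,t: s^m=t^4=1,\ sts^{-1}=t^{-1}\rangle$.) $\mu_m(\mathbb F_q)$ is the group of $m$-th roots of unity in $\mathbb F_q^\times$. *)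

theory Defs
  imports
    "HOL-Algebra.QuotRing"
    "HOL-Algebra.Module"
    "HOL-Number_Theory.Cong"
    "HOL-Library.Poly_Mapping"
    "HOL-Library.Cardinality"
    "Jordan_Normal_Form.Matrix"
begin

section \<open>Algebras over a field\<close>

text \<open>
  An algebra over the field \<open>'f\<close> is encoded as a ring (in general non-commutative) together with
  a scalar multiplication by elements of the type \<open>'f\<close>, using the library record
  \<^type>\<open>module\<close>. The library locale \<^locale>\<open>algebra\<close> only covers commutative algebras.
\<close>

definition alg_hom ::
    "('f, 'a, 'm) module_scheme \<Rightarrow> ('f, 'b, 'n) module_scheme \<Rightarrow> ('a \<Rightarrow> 'b) set"
  where "alg_hom A B =
    {h \<in> Ring.ring_hom A B. \<forall>c. \<forall>x\<in>carrier A. h (c \<odot>\<^bsub>A\<^esub> x) = c \<odot>\<^bsub>B\<^esub> h x}"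

definition alg_iso ::
    "('f, 'a, 'm) module_scheme \<Rightarrow> ('f, 'b, 'n) module_scheme \<Rightarrow> ('a \<Rightarrow> 'b) set"
  where "alg_iso A B = {h \<in> alg_hom A B. bij_betw h (carrier A) (carrier B)}"

definition quot_alg :: "('f, 'a, 'm) module_scheme \<Rightarrow> 'a set \<Rightarrow> ('f, 'a set) module"
  where "quot_alg A I =
    ring.extend (A Quot I) (module.fields (\<lambda>c C. \<Union>x\<in>C. I +>\<^bsub>A\<^esub> (c \<odot>\<^bsub>A\<^esub> x)))"

definition mat_alg :: "nat \<Rightarrow> ('f :: comm_ring_1, 'f mat) module"
  where "mat_alg n = ring_mat TYPE('f) n (module.fields smult_mat)"

definition prod_alg ::
    "'i set \<Rightarrow> ('i \<Rightarrow> ('f, 'a, 'm) module_scheme) \<Rightarrow> ('f, 'i \<Rightarrow> 'a) module"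
  where "prod_alg J A = \<lparr>
    carrier = (\<Pi>\<^sub>E j\<in>J. carrier (A j)),
    monoid.mult = (\<lambda>x y. \<lambda>j\<in>J. x j \<otimes>\<^bsub>A j\<^esub> y j),
    monoid.one = (\<lambda>j\<in>J. \<one>\<^bsub>A j\<^esub>),
    ring.zero = (\<lambda>j\<in>J. \<zero>\<^bsub>A j\<^esub>),
    ring.add = (\<lambda>x y. \<lambda>j\<in>J. x j \<oplus>\<^bsub>A j\<^esub> y j),
    module.smult = (\<lambda>c x. \<lambda>j\<in>J. c \<odot>\<^bsub>A j\<^esub> x j)\<rparr>"


section \<open>Free algebras and presentations\<close>

text \<open>
  The free monoid, written additively because the multiplication of \<^typ>\<open>'k \<Rightarrow>\<^sub>0 'b\<close>
  is the convolution with respect to the addition of the exponents \<^typ>\<open>'k\<close>.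
\<close>

datatype 'x free_mon = Wd (letters: "'x list")

instantiation free_mon :: (type) monoid_add
begin

definition zero_free_mon :: "'a free_mon"
  where "zero_free_mon = Wd []"

definition plus_free_mon :: "'a free_mon \<Rightarrow> 'a free_mon \<Rightarrow> 'a free_mon"
  where "plus_free_mon u v = Wd (letters u @ letters v)"

instance
proof
  fix a b c :: "'a free_mon"
  show "a + b + c = a + (b + c)"
    by (simp add: plus_free_mon_def)
  show "0 + a = a" "a + 0 = a"
    by (cases a; simp add: plus_free_mon_def zero_free_mon_def)+
qed

end

type_synonym ('x, 'f) free_alg_elt = "'x free_mon \<Rightarrow>\<^sub>0 'f"

definition free_alg :: "('f :: comm_ring_1, ('x, 'f) free_alg_elt) module"
  where "free_alg = \<lparr>
    carrier = UNIV, monoid.mult = (*), monoid.one = 1, ring.zero = 0, ring.add = (+),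
    module.smult = (\<lambda>c x. Poly_Mapping.single 0 c * x)\<rparr>"

definition gen :: "'x \<Rightarrow> ('x, 'f :: comm_ring_1) free_alg_elt"
  where "gen x = Poly_Mapping.single (Wd [x]) 1"

definition presented_alg ::
    "('x, 'f :: comm_ring_1) free_alg_elt set \<Rightarrow> ('f, ('x, 'f) free_alg_elt set) module"
  where "presented_alg rels = quot_alg free_alg (Idl\<^bsub>free_alg\<^esub> rels)"

definition pres_gen ::
    "('x, 'f :: comm_ring_1) free_alg_elt set \<Rightarrow> 'x \<Rightarrow> ('x, 'f) free_alg_elt set"
  where "pres_gen rels x = (Idl\<^bsub>free_alg\<^esub> rels) +>\<^bsub>free_alg\<^esub> gen x"

lemma free_alg_ring: "ring (free_alg :: ('f :: comm_ring_1, ('x, 'f) free_alg_elt) module)"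
proof (rule ringI)
  show "abelian_group (free_alg :: ('f, ('x, 'f) free_alg_elt) module)"
  proof (rule abelian_groupI)
    fix x :: "('x, 'f) free_alg_elt"
    show "\<exists>y\<in>carrier free_alg. y \<oplus>\<^bsub>free_alg\<^esub> x = \<zero>\<^bsub>free_alg\<^esub>"
      by (rule bexI[of _ "- x"]) (simp_all add: free_alg_def)
  qed (simp_all add: free_alg_def algebra_simps)
  show "Group.monoid (free_alg :: ('f, ('x, 'f) free_alg_elt) module)"
    by (rule monoidI) (simp_all add: free_alg_def algebra_simps)
qed (simp_all add: free_alg_def algebra_simps)

lemma Idl_free_alg_ideal: "ideal (Idl\<^bsub>free_alg\<^esub> rels) free_alg"
  by (rule ring.genideal_ideal[OF free_alg_ring]) (simp add: free_alg_def)

lemma presented_alg_ring: "ring (presented_alg rels)"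
proof -
  have "ring (free_alg Quot (Idl\<^bsub>free_alg\<^esub> rels))"
    by (rule ideal.quotient_is_ring[OF Idl_free_alg_ideal])
  then interpret Q: ring "free_alg Quot (Idl\<^bsub>free_alg\<^esub> rels)" .
  let ?P = "presented_alg rels"
  have eq: "carrier ?P = carrier (free_alg Quot (Idl\<^bsub>free_alg\<^esub> rels))"
    "monoid.mult ?P = monoid.mult (free_alg Quot (Idl\<^bsub>free_alg\<^esub> rels))"
    "monoid.one ?P = monoid.one (free_alg Quot (Idl\<^bsub>free_alg\<^esub> rels))"
    "ring.zero ?P = ring.zero (free_alg Quot (Idl\<^bsub>free_alg\<^esub> rels))"
    "ring.add ?P = ring.add (free_alg Quot (Idl\<^bsub>free_alg\<^esub> rels))"
    by (simp_all add: presented_alg_def quot_alg_def ring.defs)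
  show ?thesis
  proof (rule ringI)
    show "abelian_group ?P"
    proof (rule abelian_groupI)
      fix x assume "x \<in> carrier ?P"
      thus "\<exists>y\<in>carrier ?P. y \<oplus>\<^bsub>?P\<^esub> x = \<zero>\<^bsub>?P\<^esub>"
        unfolding eq using Q.l_neg Q.a_inv_closed by blast
    qed (unfold eq, (rule Q.a_closed Q.zero_closed Q.a_assoc Q.a_comm Q.l_zero; assumption?)+)
    show "Group.monoid ?P"
      by (rule monoidI) (auto simp: eq Q.m_assoc)
  qed (auto simp: eq Q.l_distr Q.r_distr)
qed

lemma presented_alg_smult:
  "c \<odot>\<^bsub>presented_alg rels\<^esub> (Idl\<^bsub>free_alg\<^esub> rels +>\<^bsub>free_alg\<^esub> x)
     = Idl\<^bsub>free_alg\<^esub> rels +>\<^bsub>free_alg\<^esub> (c \<odot>\<^bsub>free_alg\<^esub> x)"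
proof -
  interpret ideal "Idl\<^bsub>free_alg\<^esub> rels" free_alg
    by (rule Idl_free_alg_ideal)
  let ?I = "Idl\<^bsub>free_alg\<^esub> rels" and ?c = "Poly_Mapping.single 0 c"
  have "c \<odot>\<^bsub>presented_alg rels\<^esub> (?I +>\<^bsub>free_alg\<^esub> x)
      = (\<Union>y \<in> ?I +>\<^bsub>free_alg\<^esub> x. ?I +>\<^bsub>free_alg\<^esub> (?c * y))"
    by (simp add: presented_alg_def quot_alg_def ring.defs module.defs free_alg_def)
  also have "\<dots> = ?I +>\<^bsub>free_alg\<^esub> (?c * x)"
  proof -
    have "?I +>\<^bsub>free_alg\<^esub> (?c * y) = ?I +>\<^bsub>free_alg\<^esub> (?c * x)"
      if y: "y \<in> ?I +>\<^bsub>free_alg\<^esub> x" for y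
    proof -
      obtain h where h: "h \<in> ?I" "y = h + x"
        using y by (auto simp: a_r_coset_def r_coset_def free_alg_def)
      have "?c * h \<in> ?I"
        using I_l_closed[of h ?c] h by (simp add: free_alg_def)
      hence "?c * y \<in> ?I +>\<^bsub>free_alg\<^esub> (?c * x)"
        using h by (auto simp: a_r_coset_def r_coset_def free_alg_def distrib_left)
      thus ?thesis
        using a_repr_independence'[of "?c * y" "?c * x"] by (simp add: free_alg_def)
    qed
    moreover have "x \<in> ?I +>\<^bsub>free_alg\<^esub> x"
      by (rule a_rcos_self) (simp add: free_alg_def)
    ultimately show ?thesis by blast
  qed
  finally show ?thesis by (simp add: free_alg_def)
qed


section \<open>The algebra $R^I_{m,q}$\<close>

datatype st_gen = Gen_s | Gen_t

definition RI_rels :: "nat \<Rightarrow> (st_gen, 'f :: comm_ring_1) free_alg_elt set"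
  where "RI_rels m =
    {gen Gen_s ^ m - 1,
     gen Gen_t ^ 2 + 1,
     gen Gen_s * gen Gen_t + gen Gen_t * gen Gen_s}"

text \<open>The coefficient field is the type \<open>'f\<close>; for $R^I_{m,q}$ it has \<open>q\<close> elements.\<close>

definition RI :: "nat \<Rightarrow> ('f :: comm_ring_1, (st_gen, 'f) free_alg_elt set) module"
  where "RI m = presented_alg (RI_rels m)"

definition RI_s :: "nat \<Rightarrow> (st_gen, 'f :: comm_ring_1) free_alg_elt set"
  where "RI_s m = pres_gen (RI_rels m) Gen_s"

definition RI_t :: "nat \<Rightarrow> (st_gen, 'f :: comm_ring_1) free_alg_elt set"
  where "RI_t m = pres_gen (RI_rels m) Gen_t"

definition mu :: "nat \<Rightarrow> 'f :: field set"
  where "mu m = {z. z \<noteq> 0 \<and> z ^ m = 1}"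

definition mu_mod_sign :: "nat \<Rightarrow> 'f :: field set set"
  where "mu_mod_sign m = (\<lambda>z. {z, - z}) ` mu m"

end

(*
  Modulo the relations every element is a(s) + b(s) t with polynomials a, b, because t a(s) = a(-s) t
  and t^2 = -1. Any homomorphism with the prescribed values on s and t sends it to the matrix with
  rows (a(z), -b(z)) and (b(-z), a(-z)), which gives uniqueness of rho_z and, conjugating by the image
  of t, the relation between rho_z and rho_(-z). Since q = 1 (mod m), there are exactly m roots of unity,
  so a polynomial vanishing on all of them is a multiple of X^m - 1 and hence zero in the algebra
  (injectivity); surjectivity is polynomial interpolation at the points z and -z, distinct as q is odd.
*)

theory Submission
  imports Defs "HOL-Number_Theory.Residues" "HOL-Computational_Algebra.Polynomial"
begin

section \<open>Free and presented algebras\<close>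

lemma free_alg_simps [simp]:
  "carrier free_alg = UNIV" "x \<otimes>\<^bsub>free_alg\<^esub> y = x * y" "\<one>\<^bsub>free_alg\<^esub> = 1" "\<zero>\<^bsub>free_alg\<^esub> = 0"
  "x \<oplus>\<^bsub>free_alg\<^esub> y = x + y" "c \<odot>\<^bsub>free_alg\<^esub> x = Poly_Mapping.single 0 c * x"
  by (simp_all add: free_alg_def)

lemma mat_alg_simps [simp]:
  "carrier (mat_alg n) = carrier_mat n n" "A \<otimes>\<^bsub>mat_alg n\<^esub> B = A * B" "\<one>\<^bsub>mat_alg n\<^esub> = 1\<^sub>m n"
  "\<zero>\<^bsub>mat_alg n\<^esub> = 0\<^sub>m n n" "A \<oplus>\<^bsub>mat_alg n\<^esub> B = A + B" "c \<odot>\<^bsub>mat_alg n\<^esub> A = c \<cdot>\<^sub>m A"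
  by (simp_all add: mat_alg_def ring_mat_def module.defs)

lemma mat_alg_ring: "ring (mat_alg n :: ('f :: comm_ring_1, 'f mat) module)"
  unfolding mat_alg_def by (rule ring_mat)

lemma sum_single_lookup:
  fixes p :: "'k \<Rightarrow>\<^sub>0 'b :: comm_monoid_add"
  shows "(\<Sum>u\<in>Poly_Mapping.keys p. Poly_Mapping.single u (Poly_Mapping.lookup p u)) = p"
  by (rule poly_mapping_eqI)
     (auto simp: lookup_sum lookup_single when_def in_keys_iff sum.delta')

text \<open>Words arise from the unit letter by letter, scalars turn words into monomials, and every
  element is the finite sum of its monomials. Generators multiply on the left only, so an induction
  never meets a product of two arbitrary elements.\<close>

lemma free_alg_induct [case_names scale unit gen_mult add]:
  fixes p :: "('x, 'f :: comm_ring_1) free_alg_elt"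
  assumes scale: "\<And>c p. P p \<Longrightarrow> P (Poly_Mapping.single 0 c * p)"
    and unit: "P 1"
    and gen_mult: "\<And>x p. P p \<Longrightarrow> P (gen x * p)"
    and add: "\<And>p q. P p \<Longrightarrow> P q \<Longrightarrow> P (p + q)"
  shows "P p"
proof -
  have word: "P (Poly_Mapping.single (Wd w) 1)" for w
  proof (induction w)
    case Nil
    have "Poly_Mapping.single (Wd []) 1 = (1 :: ('x, 'f) free_alg_elt)"
      by (metis single_one zero_free_mon_def)
    thus ?case using unit by simp
  next
    case (Cons x w)
    have "gen x * Poly_Mapping.single (Wd w) (1 :: 'f) = Poly_Mapping.single (Wd (x # w)) 1"
      by (simp add: gen_def mult_single plus_free_mon_def)
    thus ?case using gen_mult[OF Cons, of x] by simp
  qed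
  have single: "P (Poly_Mapping.single u c)" for u c
    using scale[OF word[of "letters u"], of c] by (simp add: mult_single)
  \<comment> \<open>The empty sum is the monomial with coefficient zero, so \<open>single\<close>
    also covers the start of the induction.\<close>
  have "P (\<Sum>u\<in>A. Poly_Mapping.single u (Poly_Mapping.lookup p u))" if "finite A" for A
    using that
    by (induction A rule: finite_induct) (use single[of 0 0] in \<open>simp_all add: add single\<close>)
  from this[OF finite_keys, of p] show ?thesis
    by (simp add: sum_single_lookup)
qed

section \<open>Evaluation of the free algebra at square matrices\<close>

definition linear_ext :: "('k \<Rightarrow> 'f :: comm_ring_1) \<Rightarrow> ('k \<Rightarrow>\<^sub>0 'f) \<Rightarrow> 'f"
  where "linear_ext f p = (\<Sum>k\<in>Poly_Mapping.keys p. Poly_Mapping.lookup p k * f k)"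

lemma linear_ext_add: "linear_ext f (p + q) = linear_ext f p + linear_ext f q"
  unfolding linear_ext_def
  by (rule setsum_keys_plus_distrib[of "\<lambda>k x. x * f k"]) (simp_all add: distrib_right)

lemma linear_ext_single: "linear_ext f (Poly_Mapping.single k c) = c * f k"
  by (simp add: linear_ext_def)

definition word_mat :: "nat \<Rightarrow> ('x \<Rightarrow> 'f :: comm_ring_1 mat) \<Rightarrow> 'x free_mon \<Rightarrow> 'f mat"
  where "word_mat n G u = foldr (\<lambda>x A. G x * A) (letters u) (1\<^sub>m n)"

text \<open>The homomorphism from the free algebra with \<open>x\<close> going to
  \<open>G x\<close>, provided all \<open>G x\<close> are n by n. It is built entrywise so that only
  scalars are summed: matrices of different sizes have no common zero.\<close>

definition eval_mat :: "nat \<Rightarrow> ('x \<Rightarrow> 'f :: comm_ring_1 mat) \<Rightarrow> ('x, 'f) free_alg_elt \<Rightarrow> 'f mat"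
  where "eval_mat n G p = mat n n (\<lambda>ij. linear_ext (\<lambda>u. word_mat n G u $$ ij) p)"

context
  fixes n :: nat and G :: "'x \<Rightarrow> 'f :: comm_ring_1 mat"
  assumes G: "\<And>x. G x \<in> carrier_mat n n"
begin

lemma word_mat_carrier: "word_mat n G u \<in> carrier_mat n n"
proof -
  have "foldr (\<lambda>x A. G x * A) w (1\<^sub>m n) \<in> carrier_mat n n" for w
    by (induction w) (use G in \<open>auto intro: mult_carrier_mat\<close>)
  thus ?thesis by (simp add: word_mat_def)
qed

lemma word_mat_add: "word_mat n G (u + v) = word_mat n G u * word_mat n G v"
proof -
  \<comment> \<open>A concatenated word folds its first half over the image of the second half, in
    place of the identity matrix.\<close>
  have "foldr (\<lambda>x A. G x * A) w (word_mat n G v) = foldr (\<lambda>x A. G x * A) w (1\<^sub>m n) * word_mat n G v"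
    for w
  proof (induction w)
    case Nil
    show ?case using word_mat_carrier[of v] by simp
  next
    case (Cons x w)
    have "foldr (\<lambda>x A. G x * A) w (1\<^sub>m n) \<in> carrier_mat n n"
      using word_mat_carrier[of "Wd w"] by (simp add: word_mat_def)
    with Cons show ?case
      using assoc_mult_mat[OF G[of x] _ word_mat_carrier[of v]] by simp
  qed
  thus ?thesis by (simp add: word_mat_def plus_free_mon_def)
qed

lemma eval_mat_carrier: "eval_mat n G p \<in> carrier_mat n n"
  by (simp add: eval_mat_def)

lemma eval_mat_add: "eval_mat n G (p + q) = eval_mat n G p + eval_mat n G q"
  by (rule eq_matI) (auto simp: eval_mat_def linear_ext_add)

lemma eval_mat_single: "eval_mat n G (Poly_Mapping.single u c) = c \<cdot>\<^sub>m word_mat n G u"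
  using word_mat_carrier[of u] by (intro eq_matI) (auto simp: eval_mat_def linear_ext_single)

lemma eval_mat_one: "eval_mat n G 1 = 1\<^sub>m n"
proof -
  have "eval_mat n G 1 = 1 \<cdot>\<^sub>m word_mat n G 0"
    using eval_mat_single[of 0 1] by simp
  also have "\<dots> = 1\<^sub>m n"
    by (rule eq_matI) (auto simp: word_mat_def zero_free_mon_def)
  finally show ?thesis .
qed

lemma eval_mat_gen: "eval_mat n G (gen x) = G x"
  using G[of x] by (intro eq_matI) (auto simp: gen_def eval_mat_single word_mat_def)

text \<open>For a monomial on the left, linearity in the right factor reduces the claim to two
  words, where it is \<open>word_mat_add\<close>.\<close>

lemma eval_mat_single_mult:
  "eval_mat n G (Poly_Mapping.single u c * q) = eval_mat n G (Poly_Mapping.single u c) * eval_mat n G q"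
proof -
  have *: "eval_mat n G (Poly_Mapping.single u c * (\<Sum>v\<in>A. Poly_Mapping.single v (f v)))
     = eval_mat n G (Poly_Mapping.single u c) * eval_mat n G (\<Sum>v\<in>A. Poly_Mapping.single v (f v))"
    if "finite A" for A f
    using that
  proof (induction A rule: finite_induct)
    case empty
    have "eval_mat n G 0 = 0\<^sub>m n n"
      by (rule eq_matI) (auto simp: eval_mat_def linear_ext_def)
    thus ?case using right_mult_zero_mat[OF eval_mat_carrier] by simp
  next
    case (insert v A)
    have "eval_mat n G (Poly_Mapping.single u c * Poly_Mapping.single v (f v))
        = (c * f v) \<cdot>\<^sub>m (word_mat n G u * word_mat n G v)"
      by (simp add: mult_single eval_mat_single word_mat_add)
    also have "\<dots> = eval_mat n G (Poly_Mapping.single u c) * eval_mat n G (Poly_Mapping.single v (f v))"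
      unfolding eval_mat_single
      using word_mat_carrier[of u] word_mat_carrier[of v]
      by (intro eq_matI) (auto simp: mult_ac)
    finally show ?case
      using insert
      by (simp add: distrib_left eval_mat_add
          mult_add_distrib_mat[OF eval_mat_carrier eval_mat_carrier eval_mat_carrier])
  qed
  show ?thesis
    using *[OF finite_keys[of q], of "Poly_Mapping.lookup q"] by (simp add: sum_single_lookup)
qed

text \<open>Scalars and generators are both single monomials, so each multiplicative case peels one
  off the left factor by \<open>eval_mat_single_mult\<close> and reassociates.\<close>

lemma eval_mat_mult: "eval_mat n G (p * q) = eval_mat n G p * eval_mat n G q"
proof (induction p rule: free_alg_induct)
  case (scale c p)
  thus ?case
    using assoc_mult_mat[OF eval_mat_carrier eval_mat_carrier eval_mat_carrier]
    by (simp add: mult.assoc eval_mat_single_mult)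
next
  case unit
  show ?case using left_mult_one_mat[OF eval_mat_carrier] by (simp add: eval_mat_one)
next
  case (gen_mult x p)
  thus ?case
    using assoc_mult_mat[OF eval_mat_carrier eval_mat_carrier eval_mat_carrier]
    by (simp add: mult.assoc eval_mat_single_mult gen_def)
next
  case (add p p')
  thus ?case
    by (simp add: distrib_right eval_mat_add
        add_mult_distrib_mat[OF eval_mat_carrier eval_mat_carrier eval_mat_carrier])
qed

lemma eval_mat_hom: "eval_mat n G \<in> alg_hom free_alg (mat_alg n)"
proof -
  have "eval_mat n G (Poly_Mapping.single 0 c * p) = c \<cdot>\<^sub>m eval_mat n G p" for c p
    using eval_mat_carrier[of p]
      mult_smult_assoc_mat[OF one_carrier_mat eval_mat_carrier[of p], of c]
    by (simp add: eval_mat_single_mult eval_mat_single word_mat_def zero_free_mon_def)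
  thus ?thesis
    by (auto simp: alg_hom_def intro!: ring_hom_memI
        simp: eval_mat_carrier eval_mat_mult eval_mat_add eval_mat_one)
qed

end

section \<open>Cosets and the universal property of a presentation\<close>

lemma presented_alg_simps:
  "carrier (presented_alg rels) = range (\<lambda>p. Idl\<^bsub>free_alg\<^esub> rels +>\<^bsub>free_alg\<^esub> p)"
  "(Idl\<^bsub>free_alg\<^esub> rels +>\<^bsub>free_alg\<^esub> p) \<otimes>\<^bsub>presented_alg rels\<^esub> (Idl\<^bsub>free_alg\<^esub> rels +>\<^bsub>free_alg\<^esub> q)
    = Idl\<^bsub>free_alg\<^esub> rels +>\<^bsub>free_alg\<^esub> (p * q)"
  "(Idl\<^bsub>free_alg\<^esub> rels +>\<^bsub>free_alg\<^esub> p) \<oplus>\<^bsub>presented_alg rels\<^esub> (Idl\<^bsub>free_alg\<^esub> rels +>\<^bsub>free_alg\<^esub> q)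
    = Idl\<^bsub>free_alg\<^esub> rels +>\<^bsub>free_alg\<^esub> (p + q)"
  "\<one>\<^bsub>presented_alg rels\<^esub> = Idl\<^bsub>free_alg\<^esub> rels +>\<^bsub>free_alg\<^esub> 1"
proof -
  interpret ideal "Idl\<^bsub>free_alg\<^esub> rels" free_alg
    by (rule Idl_free_alg_ideal)
  show "carrier (presented_alg rels) = range (\<lambda>p. Idl\<^bsub>free_alg\<^esub> rels +>\<^bsub>free_alg\<^esub> p)"
    by (auto simp: presented_alg_def quot_alg_def ring.defs FactRing_def A_RCOSETS_def'
        a_r_coset_def r_coset_def)
  note hom = rcos_ring_hom
  have Q: "monoid.mult (presented_alg rels) = monoid.mult (free_alg Quot (Idl\<^bsub>free_alg\<^esub> rels))"
    "ring.add (presented_alg rels) = ring.add (free_alg Quot (Idl\<^bsub>free_alg\<^esub> rels))"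
    "monoid.one (presented_alg rels) = monoid.one (free_alg Quot (Idl\<^bsub>free_alg\<^esub> rels))"
    by (simp_all add: presented_alg_def quot_alg_def ring.defs)
  show "(Idl\<^bsub>free_alg\<^esub> rels +>\<^bsub>free_alg\<^esub> p) \<otimes>\<^bsub>presented_alg rels\<^esub> (Idl\<^bsub>free_alg\<^esub> rels +>\<^bsub>free_alg\<^esub> q)
      = Idl\<^bsub>free_alg\<^esub> rels +>\<^bsub>free_alg\<^esub> (p * q)"
    unfolding Q using ring_hom_mult[OF hom, of p q] by simp
  show "(Idl\<^bsub>free_alg\<^esub> rels +>\<^bsub>free_alg\<^esub> p) \<oplus>\<^bsub>presented_alg rels\<^esub> (Idl\<^bsub>free_alg\<^esub> rels +>\<^bsub>free_alg\<^esub> q)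
      = Idl\<^bsub>free_alg\<^esub> rels +>\<^bsub>free_alg\<^esub> (p + q)"
    unfolding Q using ring_hom_add[OF hom, of p q] by simp
  show "\<one>\<^bsub>presented_alg rels\<^esub> = Idl\<^bsub>free_alg\<^esub> rels +>\<^bsub>free_alg\<^esub> 1"
    unfolding Q using ring_hom_one[OF hom] by simp
qed

text \<open>Composition with this projection turns a homomorphism out of the presented algebra into
  one on the free algebra, where it can be computed on representatives.\<close>

lemma coset_alg_hom:
  "(\<lambda>p. Idl\<^bsub>free_alg\<^esub> rels +>\<^bsub>free_alg\<^esub> p) \<in> alg_hom free_alg (presented_alg rels)"
  unfolding alg_hom_def
  by (auto intro!: ring_hom_memI simp: presented_alg_simps presented_alg_smult)

lemma alg_hom_comp:
  assumes h: "h \<in> alg_hom A B" and k: "k \<in> alg_hom B C"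
  shows "(\<lambda>x. k (h x)) \<in> alg_hom A C"
proof -
  have h': "h \<in> Ring.ring_hom A B" "\<And>c x. x \<in> carrier A \<Longrightarrow> h (c \<odot>\<^bsub>A\<^esub> x) = c \<odot>\<^bsub>B\<^esub> h x"
    and k': "k \<in> Ring.ring_hom B C" "\<And>c x. x \<in> carrier B \<Longrightarrow> k (c \<odot>\<^bsub>B\<^esub> x) = c \<odot>\<^bsub>C\<^esub> k x"
    using h k by (simp_all add: alg_hom_def)
  note hom = ring_hom_memE[OF h'(1)] ring_hom_memE[OF k'(1)]
  have "(\<lambda>x. k (h x)) \<in> Ring.ring_hom A C"
    by (intro ring_hom_memI) (simp_all add: hom)
  thus ?thesis by (simp add: alg_hom_def hom h' k')
qed

lemma coset_eq_iff:
  "Idl\<^bsub>free_alg\<^esub> rels +>\<^bsub>free_alg\<^esub> p = Idl\<^bsub>free_alg\<^esub> rels +>\<^bsub>free_alg\<^esub> q \<longleftrightarrow> p - q \<in> Idl\<^bsub>free_alg\<^esub> rels"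
proof -
  interpret ideal "Idl\<^bsub>free_alg\<^esub> rels" free_alg
    by (rule Idl_free_alg_ideal)
  have mem: "p \<in> Idl\<^bsub>free_alg\<^esub> rels +>\<^bsub>free_alg\<^esub> q \<longleftrightarrow> p - q \<in> Idl\<^bsub>free_alg\<^esub> rels"
    by (auto simp: a_r_coset_def r_coset_def intro!: bexI[of _ "p - q"])
  show ?thesis
    using mem a_repr_independence'[of p q] a_rcos_self[of p] by auto
qed

lemma Idl_free_alg_closed:
  shows Idl_free_alg_zero: "0 \<in> Idl\<^bsub>free_alg\<^esub> rels"
    and Idl_free_alg_add: "p \<in> Idl\<^bsub>free_alg\<^esub> rels \<Longrightarrow> q \<in> Idl\<^bsub>free_alg\<^esub> rels \<Longrightarrow> p + q \<in> Idl\<^bsub>free_alg\<^esub> rels"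
    and Idl_free_alg_lmult: "p \<in> Idl\<^bsub>free_alg\<^esub> rels \<Longrightarrow> r * p \<in> Idl\<^bsub>free_alg\<^esub> rels"
    and Idl_free_alg_rmult: "p \<in> Idl\<^bsub>free_alg\<^esub> rels \<Longrightarrow> p * r \<in> Idl\<^bsub>free_alg\<^esub> rels"
    and Idl_free_alg_rel: "p \<in> rels \<Longrightarrow> p \<in> Idl\<^bsub>free_alg\<^esub> rels"
proof -
  interpret ideal "Idl\<^bsub>free_alg\<^esub> rels" free_alg
    by (rule Idl_free_alg_ideal)
  show "0 \<in> Idl\<^bsub>free_alg\<^esub> rels"
    "p \<in> Idl\<^bsub>free_alg\<^esub> rels \<Longrightarrow> q \<in> Idl\<^bsub>free_alg\<^esub> rels \<Longrightarrow> p + q \<in> Idl\<^bsub>free_alg\<^esub> rels"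
    "p \<in> Idl\<^bsub>free_alg\<^esub> rels \<Longrightarrow> r * p \<in> Idl\<^bsub>free_alg\<^esub> rels"
    "p \<in> Idl\<^bsub>free_alg\<^esub> rels \<Longrightarrow> p * r \<in> Idl\<^bsub>free_alg\<^esub> rels"
    using additive_subgroup.zero_closed[OF is_additive_subgroup]
      additive_subgroup.a_closed[OF is_additive_subgroup, of p q] I_l_closed[of p r] I_r_closed[of p r] by simp_all
  show "p \<in> rels \<Longrightarrow> p \<in> Idl\<^bsub>free_alg\<^esub> rels"
    using genideal_self[of rels] by auto
qed

lemma Idl_free_alg_uminus: "p \<in> Idl\<^bsub>free_alg\<^esub> rels \<Longrightarrow> - p \<in> Idl\<^bsub>free_alg\<^esub> rels"
  using Idl_free_alg_lmult[of p rels "- 1"] by simp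

lemma Idl_free_alg_diff:
  "p \<in> Idl\<^bsub>free_alg\<^esub> rels \<Longrightarrow> q \<in> Idl\<^bsub>free_alg\<^esub> rels \<Longrightarrow> p - q \<in> Idl\<^bsub>free_alg\<^esub> rels"
  using Idl_free_alg_add[of p rels "- q"] Idl_free_alg_uminus[of q rels] by simp

text \<open>Existence half of the universal property: the kernel of \<open>H\<close> is an ideal
  containing the relations, hence the ideal they generate, so \<open>H\<close> is constant on cosets
  and may be read off any representative.\<close>

lemma presented_alg_hom_exists:
  fixes H :: "('x, 'f :: comm_ring_1) free_alg_elt \<Rightarrow> 'b"
  assumes B: "ring B" and H: "H \<in> alg_hom free_alg B" and rels: "\<And>p. p \<in> rels \<Longrightarrow> H p = \<zero>\<^bsub>B\<^esub>"
  shows "\<exists>h \<in> alg_hom (presented_alg rels) B. \<forall>p. h (Idl\<^bsub>free_alg\<^esub> rels +>\<^bsub>free_alg\<^esub> p) = H p"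
proof -
  have H': "H \<in> Ring.ring_hom free_alg B" using H by (simp add: alg_hom_def)
  interpret H: ring_hom_ring free_alg B H
    by (rule ring_hom_ringI2[OF free_alg_ring B H'])
  have "rels \<subseteq> a_kernel free_alg B H"
    unfolding a_kernel_def' by (intro subsetI CollectI conjI rels) simp
  hence "Idl\<^bsub>free_alg\<^esub> rels \<subseteq> a_kernel free_alg B H"
    by (rule H.R.genideal_minimal[OF H.kernel_is_ideal])
  hence ker: "H p = \<zero>\<^bsub>B\<^esub>" if "p \<in> Idl\<^bsub>free_alg\<^esub> rels" for p
    unfolding a_kernel_def' using that by blast
  define h where "h = (\<lambda>C. H (SOME p. Idl\<^bsub>free_alg\<^esub> rels +>\<^bsub>free_alg\<^esub> p = C))"
  have h: "h (Idl\<^bsub>free_alg\<^esub> rels +>\<^bsub>free_alg\<^esub> p) = H p" for p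
  proof -
    define p' where "p' = (SOME p'. Idl\<^bsub>free_alg\<^esub> rels +>\<^bsub>free_alg\<^esub> p' = Idl\<^bsub>free_alg\<^esub> rels +>\<^bsub>free_alg\<^esub> p)"
    have "Idl\<^bsub>free_alg\<^esub> rels +>\<^bsub>free_alg\<^esub> p' = Idl\<^bsub>free_alg\<^esub> rels +>\<^bsub>free_alg\<^esub> p"
      unfolding p'_def by (rule someI) (rule refl)
    hence "H (p' - p) = \<zero>\<^bsub>B\<^esub>" by (intro ker) (simp add: coset_eq_iff)
    \<comment> \<open>Splitting \<open>p'\<close> in this way needs only additivity of
      \<open>H\<close> and avoids subtraction in \<open>B\<close>.\<close>
    moreover have "H ((p' - p) + p) = H (p' - p) \<oplus>\<^bsub>B\<^esub> H p"
      using ring_hom_add[OF H', of "p' - p" p] by simp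
    moreover have "H p \<in> carrier B"
      using ring_hom_closed[OF H', of p] by simp
    ultimately have "H p' = H p" by simp
    thus ?thesis by (simp add: h_def p'_def)
  qed
  have "h \<in> alg_hom (presented_alg rels) B"
    unfolding alg_hom_def
  proof (intro CollectI conjI allI ballI ring_hom_memI)
    fix x y assume "x \<in> carrier (presented_alg rels)" "y \<in> carrier (presented_alg rels)"
    then obtain p q where [simp]:
      "x = Idl\<^bsub>free_alg\<^esub> rels +>\<^bsub>free_alg\<^esub> p" "y = Idl\<^bsub>free_alg\<^esub> rels +>\<^bsub>free_alg\<^esub> q"
      unfolding presented_alg_simps(1) by blast
    show "h (x \<otimes>\<^bsub>presented_alg rels\<^esub> y) = h x \<otimes>\<^bsub>B\<^esub> h y"
      "h (x \<oplus>\<^bsub>presented_alg rels\<^esub> y) = h x \<oplus>\<^bsub>B\<^esub> h y"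
      using ring_hom_mult[OF H', of p q] ring_hom_add[OF H', of p q]
      by (simp_all add: presented_alg_simps h)
  next
    fix c x assume "x \<in> carrier (presented_alg rels)"
    then obtain p where [simp]: "x = Idl\<^bsub>free_alg\<^esub> rels +>\<^bsub>free_alg\<^esub> p"
      unfolding presented_alg_simps(1) by blast
    show "h x \<in> carrier B"
      using ring_hom_closed[OF H', of p] by (simp add: h)
    show "h (c \<odot>\<^bsub>presented_alg rels\<^esub> x) = c \<odot>\<^bsub>B\<^esub> h x"
      using H by (simp add: presented_alg_smult h alg_hom_def)
  next
    show "h \<one>\<^bsub>presented_alg rels\<^esub> = \<one>\<^bsub>B\<^esub>"
      using ring_hom_one[OF H'] by (simp add: presented_alg_simps h)
  qed
  thus ?thesis using h by blast
qed

section \<open>Polynomials in one element\<close>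

text \<open>Horner's scheme for a(g), with coefficients placed at the empty word. Multiplying by
  \<open>g\<close> on the left makes left multiplication by \<open>g\<close> a plain shift of the
  coefficients.\<close>

definition subst :: "('x, 'f :: comm_ring_1) free_alg_elt \<Rightarrow> 'f poly \<Rightarrow> ('x, 'f) free_alg_elt"
  where "subst g a = foldr (\<lambda>c p. Poly_Mapping.single 0 c + g * p) (coeffs a) 0"

text \<open>Scalars sit at the empty word, which is neutral on both sides, so only the commutativity
  of the coefficients matters.\<close>

lemma scalar_commute:
  fixes p :: "('x, 'f :: comm_ring_1) free_alg_elt"
  shows "Poly_Mapping.single 0 c * p = p * Poly_Mapping.single 0 c"
proof -
  have "Poly_Mapping.single 0 c * (\<Sum>u\<in>A. Poly_Mapping.single u (f u))
      = (\<Sum>u\<in>A. Poly_Mapping.single u (f u)) * Poly_Mapping.single 0 c" for A f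
    by (simp add: sum_distrib_left sum_distrib_right mult_single mult.commute)
  from this[of "Poly_Mapping.lookup p" "Poly_Mapping.keys p"] show ?thesis
    by (simp add: sum_single_lookup)
qed

lemma subst_0 [simp]: "subst g 0 = 0"
  by (simp add: subst_def)

lemma subst_pCons: "subst g (pCons c a) = Poly_Mapping.single 0 c + g * subst g a"
  by (auto simp: subst_def cCons_def)

lemma subst_add: "subst g (a + b) = subst g a + subst g b"
  by (induction a b rule: poly_induct2) (simp_all add: subst_pCons single_add algebra_simps)

lemma subst_smult: "subst g (smult c a) = Poly_Mapping.single 0 c * subst g a"
proof (induction a)
  case (pCons d a)
  have "g * (Poly_Mapping.single 0 c * subst g a) = Poly_Mapping.single 0 c * (g * subst g a)"
    by (metis mult.assoc scalar_commute)
  with pCons show ?case by (simp add: subst_pCons distrib_left mult_single)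
qed simp

lemma subst_uminus: "subst g (- a) = - subst g a"
  using subst_add[of g a "- a"] by (simp add: eq_neg_iff_add_eq_0 add.commute)

lemma subst_diff: "subst g (a - b) = subst g a - subst g b"
  using subst_add[of g a "- b"] by (simp add: subst_uminus)

text \<open>Together with \<open>subst_diff\<close>, this turns a multiple of X^m - 1 into a
  multiple of g^m - 1.\<close>

lemma subst_monom_mult: "subst g (monom 1 k * a) = g ^ k * subst g a"
  by (induction k) (simp_all add: monom_Suc subst_pCons mult.assoc flip: one_pCons)

text \<open>The polynomial a(-X), which appears when \<open>t\<close> is moved past a(s), because ts
  = -st.\<close>

definition reflect_arg :: "'f :: comm_ring_1 poly \<Rightarrow> 'f poly"
  where "reflect_arg a = pcompose a [:0, - 1:]"

lemma subst_reflect_arg_pCons: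
  "subst g (reflect_arg (pCons c a)) = Poly_Mapping.single 0 c - g * subst g (reflect_arg a)"
proof -
  have "reflect_arg (pCons c a) = pCons c (- reflect_arg a)"
    by (simp add: reflect_arg_def pcompose_pCons)
  thus ?thesis by (simp add: subst_pCons subst_uminus)
qed

text \<open>Newton interpolation: the product \<open>l\<close> vanishes at the old nodes but not at
  the new one, so a multiple of it corrects the value there.\<close>

lemma ex_poly_interpolation:
  fixes f :: "'a :: field \<Rightarrow> 'a"
  assumes "finite S"
  shows "\<exists>p. \<forall>x\<in>S. poly p x = f x"
  using assms
proof (induction S rule: finite_induct)
  case (insert y S)
  then obtain p where p: "\<And>x. x \<in> S \<Longrightarrow> poly p x = f x" by blast
  define l where "l = (\<Prod>x\<in>S. [:- x, 1:])"
  have l: "poly l y \<noteq> 0" "\<And>x. x \<in> S \<Longrightarrow> poly l x = 0"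
    using insert.hyps by (auto simp: l_def poly_prod)
  have "\<forall>x\<in>insert y S. poly (p + smult ((f y - poly p y) / poly l y) l) x = f x"
    using l p by auto
  thus ?case by blast
qed simp


section \<open>Roots of unity in a finite field\<close>

text \<open>Multiplication by \<open>x\<close> permutes the nonzero elements, so their product does
  not change when every factor is scaled by \<open>x\<close>; being nonzero, it cancels.\<close>

lemma fermat_finite_field:
  fixes x :: "'f :: {field, finite}"
  assumes "x \<noteq> 0"
  shows "x ^ (CARD('f) - 1) = 1"
proof -
  have "(\<Prod>y\<in>UNIV-{0}. y) = (\<Prod>y\<in>UNIV-{0}. x * y)"
    by (rule prod.reindex_bij_witness[of _ "\<lambda>y. x * y" "\<lambda>y. y / x"]) (use assms in auto)
  also have "\<dots> = x ^ (CARD('f) - 1) * (\<Prod>y\<in>UNIV-{0}. y)"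
    by (simp add: prod.distrib)
  finally show ?thesis by simp
qed

lemma degree_monom_minus_1: "k > 0 \<Longrightarrow> degree (monom 1 k - 1 :: 'a :: field poly) = k"
  by (rule antisym, rule degree_le) (auto simp: coeff_1 intro!: le_degree)

text \<open>Let n be the number of nonzero field elements and write X^n - 1 = (X^m - 1) g. All n of
  them are roots of the left side and at most n - m are roots of g, which leaves at least m for X^m
  - 1; its degree allows no more.\<close>

lemma card_mu:
  assumes "m > 0" and "m dvd CARD('f :: {field, finite}) - 1"
  shows "card (mu m :: 'f set) = m"
proof -
  let ?X = "\<lambda>k. monom 1 k - 1 :: 'f poly"
  let ?n = "CARD('f) - 1"
  \<comment> \<open>Positivity of \<open>?n\<close> makes \<open>?X ?n\<close> nonzero, and with it
    the cofactor \<open>g\<close>, so that the degree formula and the root bound apply to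
    \<open>g\<close>.\<close>
  have "card {0, 1 :: 'f} \<le> CARD('f)" by (intro card_mono) auto
  hence n: "?n > 0" by simp
  have nz: "?X k \<noteq> 0" if "k > 0" for k
    using degree_monom_minus_1[OF that, where 'a = 'f] that by auto
  have mu: "mu m = {x. poly (?X m) x = 0}"
    using assms by (auto simp: mu_def poly_monom zero_power)
  obtain k where k: "?n = m * k" using assms by auto
  have "?X m dvd ?X ?n"
  proof -
    have "(monom 1 m :: 'f poly) - 1 dvd monom 1 m ^ k - 1"
      by (rule dvdI) (rule power_diff_1_eq)
    thus ?thesis by (simp only: k monom_power power_one)
  qed
  then obtain g where g: "?X ?n = ?X m * g" by auto
  have g0: "g \<noteq> 0" using g nz[OF n] by auto
  have "?n = m + degree g"
    using degree_monom_minus_1[OF n, where 'a = 'f] degree_monom_minus_1[OF assms(1), where 'a = 'f]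
      degree_mult_eq[OF nz[OF assms(1)] g0] g by simp
  moreover have "?n \<le> card {x. poly (?X m) x = 0} + card {x. poly g x = 0}"
  proof -
    have "?n = card (UNIV - {0 :: 'f})" by simp
    also have "\<dots> \<le> card ({x. poly (?X m) x = 0} \<union> {x. poly g x = 0})"
    proof (rule card_mono)
      show "UNIV - {0} \<subseteq> {x. poly (?X m) x = 0} \<union> {x. poly g x = 0}"
      proof
        fix x :: 'f assume "x \<in> UNIV - {0}"
        hence "poly (?X ?n) x = 0" using fermat_finite_field[of x] by (simp add: poly_monom)
        thus "x \<in> {x. poly (?X m) x = 0} \<union> {x. poly g x = 0}" unfolding g by auto
      qed
    qed simp
    also have "\<dots> \<le> card {x. poly (?X m) x = 0} + card {x. poly g x = 0}"
      by (rule card_Un_le)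
    finally show ?thesis .
  qed
  moreover have "card {x. poly g x = 0} \<le> degree g"
    by (rule card_poly_roots_bound[OF g0])
  moreover have "card {x. poly (?X m) x = 0} \<le> m"
    using card_poly_roots_bound[OF nz[OF assms(1)]] degree_monom_minus_1[OF assms(1), where 'a = 'f]
    by simp
  ultimately show ?thesis unfolding mu by linarith
qed

text \<open>The remainder modulo X^m - 1 still vanishes at the m points of \<open>mu m\<close>, but
  its degree is below m, so it is zero.\<close>

lemma dvd_if_vanishes_on_mu:
  fixes a :: "'f :: {field, finite} poly"
  assumes "m > 0" and "m dvd CARD('f) - 1" and "\<And>z. z \<in> mu m \<Longrightarrow> poly a z = 0"
  shows "(monom 1 m - 1) dvd a"
proof (rule ccontr)
  let ?X = "monom 1 m - 1 :: 'f poly"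
  assume ndvd: "\<not> ?X dvd a"
  hence r: "a mod ?X \<noteq> 0" by (simp add: mod_eq_0_iff_dvd)
  have X: "?X \<noteq> 0" using degree_monom_minus_1[OF assms(1), where 'a = 'f] assms(1) by auto
  have "poly (a mod ?X) z = 0" if "z \<in> mu m" for z
  proof -
    have "poly (a div ?X) z * poly ?X z + poly (a mod ?X) z = 0"
      using assms(3)[OF that] by (simp only: div_mult_mod_eq flip: poly_mult poly_add)
    thus ?thesis using that by (simp add: poly_monom mu_def)
  qed
  hence "card (mu m :: 'f set) \<le> card {z. poly (a mod ?X) z = 0}"
    by (intro card_mono) auto
  also have "\<dots> \<le> degree (a mod ?X)" by (rule card_poly_roots_bound[OF r])
  also have "\<dots> < m"
    using degree_mod_less[OF X, of a] r degree_monom_minus_1[OF assms(1), where 'a = 'f] by simp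
  finally show False using card_mu[OF assms(1,2)] by simp
qed

text \<open>If 2 were zero, the characteristic would be 2 and would divide the number of
  elements.\<close>

lemma two_neq_0_if_odd_CARD:
  assumes "odd CARD('f :: {field, finite})"
  shows "(2 :: 'f) \<noteq> 0"
proof
  assume "(2 :: 'f) = 0"
  hence "of_nat 2 = (0 :: 'f)" by simp
  hence "CHAR('f) dvd 2" by (simp only: of_nat_eq_0_iff_char_dvd)
  moreover have "CHAR('f) \<noteq> 1" by simp
  ultimately have "CHAR('f) = 2" by (metis prime_nat_iff two_is_prime_nat)
  thus False using CHAR_dvd_CARD[where 'a = 'f] assms by simp
qed


section \<open>The algebra $R^I_{m,q}$ and its two-dimensional representations\<close>

abbreviation mat2 :: "'a \<Rightarrow> 'a \<Rightarrow> 'a \<Rightarrow> 'a \<Rightarrow> 'a mat"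
  where "mat2 a b c d \<equiv> mat_of_rows_list 2 [[a, b], [c, d]]"

lemma mat2_carrier: "mat2 a b c d \<in> carrier_mat 2 2"
  by (simp add: mat_of_rows_list_def numeral_2_eq_2)

lemma mat2_index:
  "mat2 a b c d $$ (0, 0) = a" "mat2 a b c d $$ (0, 1) = b"
  "mat2 a b c d $$ (1, 0) = c" "mat2 a b c d $$ (1, 1) = d"
  by (simp_all add: mat_of_rows_list_def)

lemma mat2_eq_iff: "mat2 a b c d = mat2 a' b' c' d' \<longleftrightarrow> a = a' \<and> b = b' \<and> c = c' \<and> d = d'"
  by (metis mat2_index)

lemma eq_mat2I:
  assumes "A \<in> carrier_mat 2 2" "A $$ (0, 0) = a" "A $$ (0, 1) = b" "A $$ (1, 0) = c" "A $$ (1, 1) = d"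
  shows "A = mat2 a b c d"
proof (rule eq_matI)
  fix i j assume "i < dim_row (mat2 a b c d)" "j < dim_col (mat2 a b c d)"
  hence "i < 2" "j < 2" using mat2_carrier[of a b c d] by auto
  thus "A $$ (i, j) = mat2 a b c d $$ (i, j)"
    using assms(2-5) by (auto dest!: less_2_cases simp: mat2_index[simplified])
qed (use assms(1) mat2_carrier[of a b c d] in auto)

lemma mat2_simps:
  fixes a b c d :: "'a :: comm_ring_1"
  shows "mat2 a b c d + mat2 a' b' c' d' = mat2 (a + a') (b + b') (c + c') (d + d')"
    and "mat2 a b c d * mat2 a' b' c' d'
      = mat2 (a * a' + b * c') (a * b' + b * d') (c * a' + d * c') (c * b' + d * d')"
    and "x \<cdot>\<^sub>m mat2 a b c d = mat2 (x * a) (x * b) (x * c) (x * d)"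
    and "1\<^sub>m 2 = mat2 1 0 0 (1 :: 'a)" and "0\<^sub>m 2 2 = mat2 0 0 0 (0 :: 'a)"
  by (rule eq_mat2I;
      (rule mult_carrier_mat[OF mat2_carrier mat2_carrier]
        | simp add: mat_of_rows_list_def scalar_prod_def numeral_2_eq_2))+

section \<open>Normal forms modulo the relations\<close>

definition normal_form :: "'f :: comm_ring_1 poly \<Rightarrow> 'f poly \<Rightarrow> (st_gen, 'f) free_alg_elt"
  where "normal_form a b = subst (gen Gen_s) a + subst (gen Gen_s) b * gen Gen_t"

abbreviation RI_class :: "nat \<Rightarrow> (st_gen, 'f :: comm_ring_1) free_alg_elt \<Rightarrow> (st_gen, 'f) free_alg_elt set"
  where "RI_class m p \<equiv> Idl\<^bsub>free_alg\<^esub> (RI_rels m) +>\<^bsub>free_alg\<^esub> p"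

text \<open>Induction along Horner's scheme: one more coefficient changes the difference to a
  multiple of the relation st + ts minus \<open>s\<close> times the previous difference.\<close>

lemma subst_commute_mod_rels:
  "gen Gen_t * subst (gen Gen_s) a - subst (gen Gen_s) (reflect_arg a) * gen Gen_t
    \<in> Idl\<^bsub>free_alg\<^esub> (RI_rels m :: (st_gen, 'f :: comm_ring_1) free_alg_elt set)" (is "_ \<in> ?I")
proof (induction a)
  case 0
  show ?case by (simp add: reflect_arg_def Idl_free_alg_zero)
next
  case (pCons c a)
  let ?s = "gen Gen_s :: (st_gen, 'f) free_alg_elt" and ?t = "gen Gen_t :: (st_gen, 'f) free_alg_elt"
  have "?t * Poly_Mapping.single 0 c = Poly_Mapping.single 0 c * ?t"
    by (rule scalar_commute[symmetric])
  hence "?t * subst ?s (pCons c a) - subst ?s (reflect_arg (pCons c a)) * ?t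
      = (?s * ?t + ?t * ?s) * subst ?s a
        - ?s * (?t * subst ?s a - subst ?s (reflect_arg a) * ?t)"
    by (simp add: subst_reflect_arg_pCons) (simp add: subst_pCons algebra_simps)
  also have "\<dots> \<in> ?I"
    by (intro Idl_free_alg_diff Idl_free_alg_rmult Idl_free_alg_lmult pCons.IH Idl_free_alg_rel)
       (simp add: RI_rels_def)
  finally show ?case .
qed

text \<open>Modulo the ideal, the normal forms contain 1 and are stable under sums, scalars and left
  multiplication by \<open>s\<close> and \<open>t\<close>, which is all that
  \<open>free_alg_induct\<close> asks for. The degrees are not bounded, so \<open>s\<close> acts as
  a shift.\<close>

lemma ex_normal_form_mod_rels:
  fixes p :: "(st_gen, 'f :: comm_ring_1) free_alg_elt"
  shows "\<exists>a b. p - normal_form a b \<in> Idl\<^bsub>free_alg\<^esub> (RI_rels m)" (is "\<exists>a b. _ \<in> ?I")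
proof (induction p rule: free_alg_induct)
  case (scale c p)
  then obtain a b where ab: "p - normal_form a b \<in> ?I" by blast
  have "Poly_Mapping.single 0 c * p - normal_form (smult c a) (smult c b)
      = Poly_Mapping.single 0 c * (p - normal_form a b)"
    by (simp add: normal_form_def subst_smult algebra_simps)
  thus ?case using Idl_free_alg_lmult[OF ab] by metis
next
  case unit
  have "1 - normal_form [:1:] 0 = (0 :: (st_gen, 'f) free_alg_elt)"
    by (simp add: normal_form_def subst_pCons)
  thus ?case using Idl_free_alg_zero by metis
next
  case (gen_mult x p)
  then obtain a b where ab: "p - normal_form a b \<in> ?I" by blast
  let ?s = "gen Gen_s :: (st_gen, 'f) free_alg_elt" and ?t = "gen Gen_t :: (st_gen, 'f) free_alg_elt"
  show ?case
  proof (cases x)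
    case Gen_s
    have "gen x * p - normal_form (pCons 0 a) (pCons 0 b) = ?s * (p - normal_form a b)"
      by (simp add: Gen_s normal_form_def subst_pCons algebra_simps)
    thus ?thesis using Idl_free_alg_lmult[OF ab] by metis
  next
    case Gen_t
    \<comment> \<open>Modulo the relations t (a(s) + b(s) t) = a(-s) t + b(-s) t^2, and t^2 = -1
      gives the new pair. The correction terms are the two commutations and a multiple of t^2 +
      1.\<close>
    have "gen x * p - normal_form (- reflect_arg b) (reflect_arg a)
        = ?t * (p - normal_form a b)
          + (?t * subst ?s a - subst ?s (reflect_arg a) * ?t)
          + (?t * subst ?s b - subst ?s (reflect_arg b) * ?t) * ?t
          + subst ?s (reflect_arg b) * (?t ^ 2 + 1)"
      by (simp add: Gen_t normal_form_def subst_uminus power2_eq_square algebra_simps)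
    also have "\<dots> \<in> ?I"
      by (intro Idl_free_alg_add Idl_free_alg_lmult[OF ab] subst_commute_mod_rels
          Idl_free_alg_rmult Idl_free_alg_lmult[OF Idl_free_alg_rel])
         (simp add: RI_rels_def)
    finally show ?thesis by blast
  qed
next
  case (add p q)
  then obtain a b a' b' where "p - normal_form a b \<in> ?I" "q - normal_form a' b' \<in> ?I" by blast
  hence "(p - normal_form a b) + (q - normal_form a' b') \<in> ?I" by (rule Idl_free_alg_add)
  moreover have "p + q - normal_form (a + a') (b + b') = (p - normal_form a b) + (q - normal_form a' b')"
    by (simp add: normal_form_def subst_add algebra_simps)
  ultimately show ?case by metis
qed

lemma RI_normal_form:
  assumes "x \<in> carrier (RI m :: ('f :: comm_ring_1, (st_gen, 'f) free_alg_elt set) module)"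
  obtains a b where "x = RI_class m (normal_form a b)"
proof -
  obtain p where "x = RI_class m p"
    using assms by (auto simp: RI_def presented_alg_simps)
  moreover obtain a b where "p - normal_form a b \<in> Idl\<^bsub>free_alg\<^esub> (RI_rels m)"
    using ex_normal_form_mod_rels by blast
  ultimately show ?thesis using that by (simp add: coset_eq_iff)
qed

text \<open>A multiple of X^m - 1 evaluates at \<open>s\<close> to a multiple of the relation s^m -
  1, and the ideal absorbs the factor \<open>t\<close>. This is the last step of
  injectivity.\<close>

lemma normal_form_mem_rels:
  assumes "(monom 1 m - 1) dvd a" and "(monom 1 m - 1) dvd b"
  shows "normal_form a b \<in> Idl\<^bsub>free_alg\<^esub> (RI_rels m)"
proof -
  have "subst (gen Gen_s) c \<in> Idl\<^bsub>free_alg\<^esub> (RI_rels m)" if dvd: "(monom 1 m - 1) dvd c" for c :: "'a poly"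
  proof -
    obtain d where c: "c = (monom 1 m - 1) * d" using dvd by blast
    have "subst (gen Gen_s) c = (gen Gen_s ^ m - 1) * subst (gen Gen_s) d"
      by (simp add: c left_diff_distrib subst_diff subst_monom_mult)
    thus ?thesis
      by (simp add: Idl_free_alg_rmult Idl_free_alg_rel RI_rels_def)
  qed
  thus ?thesis
    using assms by (simp add: normal_form_def Idl_free_alg_add Idl_free_alg_rmult)
qed

lemma normal_form_diff: "normal_form a b - normal_form a' b' = normal_form (a - a') (b - b')"
  by (simp add: normal_form_def subst_diff algebra_simps)

section \<open>Homomorphisms on normal forms\<close>

lemma hom_normal_form:
  fixes z :: "'f :: comm_ring_1"
  assumes H: "H \<in> alg_hom free_alg (mat_alg 2)"
    and s: "H (gen Gen_s) = mat2 z 0 0 (- z)" and t: "H (gen Gen_t) = mat2 0 (- 1) 1 0"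
  shows "H (normal_form a b) = mat2 (poly a z) (- poly b z) (poly b (- z)) (poly a (- z))"
proof -
  have H': "H \<in> Ring.ring_hom free_alg (mat_alg 2)" using H by (simp add: alg_hom_def)
  have mult: "H (p * q) = H p * H q" and add: "H (p + q) = H p + H q" for p q
    using ring_hom_mult[OF H', of p q] ring_hom_add[OF H', of p q] by simp_all
  \<comment> \<open>The factor 1 exhibits the constant as a scalar multiple of the unit, the form in
    which homogeneity of \<open>H\<close> applies.\<close>
  have "H (Poly_Mapping.single 0 c * 1) = c \<cdot>\<^sub>m H 1" for c
    using H by (simp add: alg_hom_def del: mult_1_right)
  hence scalar: "H (Poly_Mapping.single 0 c) = mat2 c 0 0 c" for c
    using ring_hom_one[OF H'] by (simp add: mat2_simps)
  \<comment> \<open>Polynomials in \<open>s\<close> go to diagonal matrices; the image of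
    \<open>t\<close> on the right then moves the part from \<open>b\<close> off the
    diagonal.\<close>
  have subst: "H (subst (gen Gen_s) a) = mat2 (poly a z) 0 0 (poly a (- z))" for a
  proof (induction a)
    case 0
    show ?case using scalar[of 0] by simp
  next
    case (pCons c a)
    thus ?case by (simp add: subst_pCons mult add scalar s mat2_simps)
  qed
  show ?thesis by (simp add: normal_form_def mult add subst t mat2_simps)
qed

text \<open>The generators determine the homomorphism through the projection from the free algebra.
  Applied to an arbitrary \<open>h\<close> and to the constructed one, the formula yields
  uniqueness.\<close>

lemma RI_hom_normal_form:
  fixes z :: "'f :: comm_ring_1"
  assumes h: "h \<in> alg_hom (RI m) (mat_alg 2)"
    and "h (RI_s m) = mat2 z 0 0 (- z)" and "h (RI_t m) = mat2 0 (- 1) 1 0"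
  shows "h (RI_class m (normal_form a b)) = mat2 (poly a z) (- poly b z) (poly b (- z)) (poly a (- z))"
  by (rule hom_normal_form)
     (use assms alg_hom_comp[OF coset_alg_hom h[unfolded RI_def]]
       in \<open>simp_all add: RI_s_def RI_t_def pres_gen_def\<close>)

text \<open>The image of \<open>s\<close> has diagonal entries z and -z, so both have to be m-th
  roots of unity; in the application this comes from the evenness of m.\<close>

lemma RI_hom_exists:
  fixes z :: "'f :: comm_ring_1"
  assumes z: "z ^ m = 1" "(- z) ^ m = 1"
  shows "\<exists>h \<in> alg_hom (RI m) (mat_alg 2).
    h (RI_s m) = mat2 z 0 0 (- z) \<and> h (RI_t m) = mat2 0 (- 1) 1 0"
proof -
  define G where "G = (\<lambda>x. case x of Gen_s \<Rightarrow> mat2 z 0 0 (- z) | Gen_t \<Rightarrow> mat2 0 (- 1) 1 0)"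
  have G: "G x \<in> carrier_mat 2 2" for x
    by (cases x) (simp_all add: G_def mat2_carrier)
  let ?H = "eval_mat 2 G"
  have H: "?H \<in> alg_hom free_alg (mat_alg 2)" using G by (rule eval_mat_hom)
  have s: "?H (gen Gen_s) = mat2 z 0 0 (- z)" and t: "?H (gen Gen_t) = mat2 0 (- 1) 1 0"
    using eval_mat_gen[of G, OF G] by (simp_all, simp_all add: G_def)
  have "?H p = 0\<^sub>m 2 2" if p: "p \<in> RI_rels m" for p
  proof -
    consider "p = gen Gen_s ^ m - 1" | "p = gen Gen_t ^ 2 + 1"
      | "p = gen Gen_s * gen Gen_t + gen Gen_t * gen Gen_s"
      using p by (auto simp: RI_rels_def)
    thus ?thesis
    proof cases
      case 1
      \<comment> \<open>Read as a normal form, the relation is evaluated by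
        \<open>hom_normal_form\<close>, in place of computing the m-th power of a matrix.\<close>
      have "p = normal_form (monom 1 m - 1) 0"
        using subst_monom_mult[of "gen Gen_s :: (st_gen, 'f) free_alg_elt" m 1] by (simp add: 1 normal_form_def subst_diff one_pCons subst_pCons)
      thus ?thesis by (simp add: hom_normal_form[OF H s t] poly_monom z mat2_simps)
    next
      case 2
      thus ?thesis
        by (simp add: power2_eq_square eval_mat_add[OF G] eval_mat_mult[OF G] eval_mat_one[OF G]
            t mat2_simps)
    next
      case 3
      thus ?thesis
        by (simp add: eval_mat_add[OF G] eval_mat_mult[OF G] s t mat2_simps)
    qed
  qed
  then obtain h where "h \<in> alg_hom (presented_alg (RI_rels m)) (mat_alg 2)" "\<And>p. h (RI_class m p) = ?H p"
    using presented_alg_hom_exists[OF mat_alg_ring H, of "RI_rels m"] by auto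
  thus ?thesis
    using s t by (intro bexI[of _ h]) (simp_all add: RI_def RI_s_def RI_t_def pres_gen_def)
qed

lemma alg_hom_prod_algI:
  assumes "\<And>j. j \<in> J \<Longrightarrow> h j \<in> alg_hom A (B j)"
  shows "(\<lambda>x. \<lambda>j\<in>J. h j x) \<in> alg_hom A (prod_alg J B)"
proof -
  note hom = ring_hom_memE[where h = "h j" and R = A and S = "B j" for j]
  have "h j \<in> Ring.ring_hom A (B j)" "\<And>c x. x \<in> carrier A \<Longrightarrow> h j (c \<odot>\<^bsub>A\<^esub> x) = c \<odot>\<^bsub>B j\<^esub> h j x"
    if "j \<in> J" for j
    using assms[OF that] by (simp_all add: alg_hom_def)
  note h = this
  show ?thesis
    unfolding alg_hom_def
    by (intro CollectI conjI allI ballI ring_hom_memI)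
       (auto simp: prod_alg_def fun_eq_iff h hom[OF h(1)])
qed

theorem mainTheorem12:
  fixes m q :: nat
  assumes "m \<ge> 2" and "even m"
    and "prime q" and "odd q" and "[q = 1] (mod m)"
    and "CARD('f :: {field, finite}) = q"
  shows "\<exists>\<rho> :: 'f \<Rightarrow> (st_gen, 'f) free_alg_elt set \<Rightarrow> 'f mat.
    (\<forall>z \<in> mu m.
        \<rho> z \<in> alg_hom (RI m) (mat_alg 2)
      \<and> \<rho> z (RI_s m) = mat_of_rows_list 2 [[z, 0], [0, - z]]
      \<and> \<rho> z (RI_t m) = mat_of_rows_list 2 [[0, - 1], [1, 0]]
      \<and> (\<forall>h \<in> alg_hom (RI m) (mat_alg 2).
            h (RI_s m) = mat_of_rows_list 2 [[z, 0], [0, - z]]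
          \<and> h (RI_t m) = mat_of_rows_list 2 [[0, - 1], [1, 0]]
          \<longrightarrow> (\<forall>x \<in> carrier (RI m). h x = \<rho> z x)))
  \<and> (\<forall>z \<in> mu m. \<exists>P \<in> Units (mat_alg 2 :: ('f, 'f mat) module).
        \<forall>x \<in> carrier (RI m).
          \<rho> (- z) x = P \<otimes>\<^bsub>mat_alg 2\<^esub> \<rho> z x \<otimes>\<^bsub>mat_alg 2\<^esub> inv\<^bsub>mat_alg 2\<^esub> P)
  \<and> (\<forall>r. (\<forall>C \<in> mu_mod_sign m. r C \<in> C) \<longrightarrow>
        (\<lambda>x. \<lambda>C \<in> mu_mod_sign m. \<rho> (r C) x)
          \<in> alg_iso (RI m) (prod_alg (mu_mod_sign m) (\<lambda>C. mat_alg 2)))"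
proof -
  have m: "m > 0" "m dvd CARD('f) - 1"
    using assms cong_to_1_nat[of q m] by auto
  \<comment> \<open>Evenness of \<open>m\<close> makes the roots of unity stable under sign.\<close>
  have minus_mu: "- z \<in> mu m" if "z \<in> mu m" for z :: 'f
    using that assms by (simp add: mu_def)
  have "\<forall>z \<in> mu m. \<exists>h. h \<in> alg_hom (RI m) (mat_alg 2)
      \<and> h (RI_s m) = mat2 z 0 0 (- z :: 'f) \<and> h (RI_t m) = mat2 0 (- 1) 1 0"
    using RI_hom_exists minus_mu unfolding mu_def by blast
  then obtain \<rho> :: "'f \<Rightarrow> (st_gen, 'f) free_alg_elt set \<Rightarrow> 'f mat"
    where \<rho>: "\<And>z. z \<in> mu m \<Longrightarrow> \<rho> z \<in> alg_hom (RI m) (mat_alg 2)"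
      "\<And>z. z \<in> mu m \<Longrightarrow> \<rho> z (RI_s m) = mat2 z 0 0 (- z)"
      "\<And>z. z \<in> mu m \<Longrightarrow> \<rho> z (RI_t m) = mat2 0 (- 1) 1 0"
    by metis
  note \<rho>_nf = RI_hom_normal_form[OF \<rho>]

  have unique: "h x = \<rho> z x"
    if "z \<in> mu m" "h \<in> alg_hom (RI m) (mat_alg 2)" "h (RI_s m) = mat2 z 0 0 (- z)"
      "h (RI_t m) = mat2 0 (- 1) 1 0" "x \<in> carrier (RI m)" for z h x
    by (rule RI_normal_form[OF that(5)]) (simp add: RI_hom_normal_form[OF that(2-4)] \<rho>_nf[OF that(1,1,1)])

  have conjugate: "\<exists>P \<in> Units (mat_alg 2 :: ('f, 'f mat) module). \<forall>x \<in> carrier (RI m).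
      \<rho> (- z) x = P \<otimes>\<^bsub>mat_alg 2\<^esub> \<rho> z x \<otimes>\<^bsub>mat_alg 2\<^esub> inv\<^bsub>mat_alg 2\<^esub> P"
    if z: "z \<in> mu m" for z
  proof -
    \<comment> \<open>The conjugating matrix is the image of \<open>t\<close>: since t s t^-1 = -s,
      it carries the image of \<open>s\<close> to its negative and fixes the image of
      \<open>t\<close>. Its square is -1, so \<open>?Q\<close> is its negative.\<close>
    let ?P = "mat2 0 (- 1) 1 0 :: 'f mat" and ?Q = "mat2 0 1 (- 1) 0 :: 'f mat"
    have PQ: "?P * ?Q = 1\<^sub>m 2" "?Q * ?P = 1\<^sub>m 2" by (simp_all add: mat2_simps)
    have PQ_carrier: "?P \<in> carrier_mat 2 2" "?Q \<in> carrier_mat 2 2" by (rule mat2_carrier)+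
    have unit: "?P \<in> Units (mat_alg 2)"
      unfolding Units_def mat_alg_simps using PQ PQ_carrier by (intro CollectI conjI bexI[of _ ?Q])
    have inv: "inv\<^bsub>mat_alg 2\<^esub> ?P = ?Q"
      by (rule monoid.inv_char[OF ring.is_monoid[OF mat_alg_ring]]) (simp_all only: mat_alg_simps PQ PQ_carrier)
    have "\<rho> (- z) x = ?P * \<rho> z x * ?Q" if "x \<in> carrier (RI m)" for x
      by (rule RI_normal_form[OF that])
         (simp add: \<rho>_nf[OF z z z] \<rho>_nf[OF minus_mu[OF z] minus_mu[OF z] minus_mu[OF z]] mat2_simps)
    thus ?thesis using unit by (intro bexI[of _ ?P]) (simp_all add: inv)
  qed

  have iso: "(\<lambda>x. \<lambda>C \<in> mu_mod_sign m. \<rho> (r C) x)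
      \<in> alg_iso (RI m) (prod_alg (mu_mod_sign m) (\<lambda>C. mat_alg 2))" (is "?h \<in> _")
    if r: "\<forall>C \<in> mu_mod_sign m. r C \<in> C" for r
  proof -
    have r_mu: "r C \<in> mu m" if "C \<in> mu_mod_sign m" for C
      using r that minus_mu by (auto simp: mu_mod_sign_def)
    have r_cases: "r {z, - z} = z \<or> r {z, - z} = - z" if "z \<in> mu m" for z
      using r that by (auto simp: mu_mod_sign_def)
    have hom: "?h \<in> alg_hom (RI m) (prod_alg (mu_mod_sign m) (\<lambda>C. mat_alg 2))"
      by (rule alg_hom_prod_algI) (use \<rho>(1) r_mu in blast)
    have inj: "inj_on ?h (carrier (RI m))"
    proof (rule inj_onI)
      fix x y assume xy: "x \<in> carrier (RI m)" "y \<in> carrier (RI m)" "?h x = ?h y"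
      obtain a b where x: "x = RI_class m (normal_form a b)" using xy(1) by (rule RI_normal_form)
      obtain a' b' where y: "y = RI_class m (normal_form a' b')" using xy(2) by (rule RI_normal_form)
      \<comment> \<open>The component at {z, -z} contains the values of both polynomials at z and at
        -z, so either choice of representative gives the vanishing at z.\<close>
      have van: "poly (a - a') z = 0 \<and> poly (b - b') z = 0" if z: "z \<in> mu m" for z
      proof -
        let ?C = "{z, - z}"
        have C: "?C \<in> mu_mod_sign m" using z by (auto simp: mu_mod_sign_def)
        hence "\<rho> (r ?C) x = \<rho> (r ?C) y" using fun_cong[OF xy(3), of ?C] by simp
        thus ?thesis
          using r_cases[OF z]
          unfolding x y \<rho>_nf[OF r_mu[OF C] r_mu[OF C] r_mu[OF C]] mat2_eq_iff by auto
      qed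
      have "(monom 1 m - 1) dvd (a - a')" "(monom 1 m - 1) dvd (b - b')"
        using van by (auto intro!: dvd_if_vanishes_on_mu[OF m])
      thus "x = y"
        by (simp add: x y coset_eq_iff normal_form_diff normal_form_mem_rels)
    qed
    have surj: "y \<in> ?h ` carrier (RI m)"
      if y: "y \<in> carrier (prod_alg (mu_mod_sign m) (\<lambda>C. mat_alg 2))" for y
    proof -
      \<comment> \<open>The diagonal entries of the component at C prescribe \<open>a\<close> at the
        representative and at its negative. Interpolating over the whole finite field lets the
        formula hold for every \<open>w\<close>.\<close>
      obtain a where a: "\<And>w. poly a w = (if r {w, - w} = w then y {w, - w} $$ (0, 0) else y {w, - w} $$ (1, 1))"
        using ex_poly_interpolation[of UNIV "\<lambda>w. if r {w, - w} = w then y {w, - w} $$ (0, 0) else y {w, - w} $$ (1, 1)"]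
        by auto
      \<comment> \<open>The minus sign undoes the one in the upper right entry -b(z).\<close>
      obtain b where b: "\<And>w. poly b w = (if r {w, - w} = w then - y {w, - w} $$ (0, 1) else y {w, - w} $$ (1, 0))"
        using ex_poly_interpolation[of UNIV "\<lambda>w. if r {w, - w} = w then - y {w, - w} $$ (0, 1) else y {w, - w} $$ (1, 0)"]
        by auto
      let ?x = "RI_class m (normal_form a b)"
      have "?h ?x C = y C" for C
      proof (cases "C \<in> mu_mod_sign m")
        case True
        define z where "z = r C"
        have z: "z \<in> mu m" using r_mu[OF True] by (simp add: z_def)
        \<comment> \<open>The second equation identifies the pair attached to -z, so the formulas at
          z and at -z refer to the same component \<open>y C\<close>.\<close>
        have C: "{z, - z} = C" "{- z, - (- z)} = C"
          using r True by (auto simp: z_def mu_mod_sign_def)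
        \<comment> \<open>Oddness of \<open>q\<close> enters here: the two interpolation conditions
          at z and -z must concern different points.\<close>
        have neq: "- z \<noteq> z"
        proof
          assume "- z = z"
          hence "2 * z = 0" by (metis add.right_inverse mult_2)
          thus False using z two_neq_0_if_odd_CARD[where 'f = 'f] assms by (simp add: mu_def)
        qed
        have ab: "poly a z = y C $$ (0, 0)" "poly a (- z) = y C $$ (1, 1)"
          "poly b z = - y C $$ (0, 1)" "poly b (- z) = y C $$ (1, 0)"
          unfolding a b C z_def[symmetric] using neq by simp_all
        have yC: "y C \<in> carrier_mat 2 2"
          using y True PiE_mem[of y "mu_mod_sign m" "\<lambda>_. carrier_mat 2 2" C]
          by (simp add: prod_alg_def)
        have "\<rho> z ?x = y C"
          unfolding \<rho>_nf[OF z z z] ab minus_minus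
          by (rule eq_mat2I[symmetric, OF yC refl refl refl refl])
        thus ?thesis using True unfolding z_def by simp
      next
        \<comment> \<open>Elements of the product are extensional, so both sides are
          \<open>undefined\<close> off the index set.\<close>
        case False
        thus ?thesis
          using y PiE_arb[of y "mu_mod_sign m" "\<lambda>_. carrier_mat 2 2" C]
          by (simp add: prod_alg_def)
      qed
      hence "y = ?h ?x" by (intro ext) (rule sym)
      moreover have "?x \<in> carrier (RI m)" by (simp add: RI_def presented_alg_simps)
      ultimately show ?thesis by blast
    qed
    have "?h ` carrier (RI m) \<subseteq> carrier (prod_alg (mu_mod_sign m) (\<lambda>C. mat_alg 2))"
      using hom by (auto simp: alg_hom_def dest: ring_hom_closed)
    with surj have "?h ` carrier (RI m) = carrier (prod_alg (mu_mod_sign m) (\<lambda>C. mat_alg 2))"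
      by blast
    thus ?thesis using hom inj by (simp add: alg_iso_def bij_betw_def)
  qed

  show ?thesis
  proof (intro exI[of _ \<rho>] conjI ballI allI impI)
    fix z :: 'f and h :: "(st_gen, 'f) free_alg_elt set \<Rightarrow> 'f mat"
      and x :: "(st_gen, 'f) free_alg_elt set"
    assume "z \<in> mu m" "h \<in> alg_hom (RI m) (mat_alg 2)"
      "h (RI_s m) = mat2 z 0 0 (- z) \<and> h (RI_t m) = mat2 0 (- 1) 1 0" "x \<in> carrier (RI m)"
    thus "h x = \<rho> z x" by (elim conjE) (rule unique)
  qed (rule \<rho> conjugate iso; assumption)+
qed

end
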